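(* Every submaximal topological gyrogroup $(G,\tau,\oplus)$ of non-measurable cardinality is strongly $\sigma$-discrete, i.e. $G$ is a countable union of closed discrete subspaces.
   Context: A gyrogroup is a nonempty set $G$ with a binary operation $\oplus$ such that: (G1) there is a unique identity $0\in G$ with $0\oplus a=a=a\oplus 0$ for all $a$; (G2) for each $x\in G$ there is a unique inverse $\ominus x\in G$ with $\ominus x\oplus x=0=x\oplus(\ominus x)$; (G3) for all $x,y\in G$ there is an automorphism $\mathrm{gyr}[x,y]$ of $(G,\oplus)$ with $x\oplus(y\oplus z)=(x\oplus y)\oplus \mathrm{gyr}[x,y](z)$ for all $z\in G$; (G4) $\mathrm{gyr}[x\oplus y,y]=\mathrm{gyr}[x,y]$ for all $x,y\in G$. A topological gyrogroup $(G,\tau,\oplus)$ is a gyrogroup with a topology such that $\oplus:G\times G\to G$ is jointly continuous and $x\mapsto\ominus x$ is continuous. Standing convention: all topological spaces considered are Hausdorff and dense in themselves (have no isolated points), unless explicitly stated otherwise. A space $X$ is submaximal if every dense subset of $X$ is open. A space is strongly $\sigma$-discrete if it is a countable union of closed discrete subspaces. A cardinal $m$ is non-measurable if the only countably additive two-valued measure defined on the family of all subsets of a set of cardinality $m$ and vanishing on all one-point sets is the zero measure. *)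

theory Defs
  imports "HOL-Analysis.Analysis"
begin

(* Carrier-based, and nonempty because it contains zero.  The gyrations are required
   to be automorphisms on the carrier only; outside G nothing is assumed. *)
locale gyrogroup =
  fixes G :: "'a set"
    and add :: "'a \<Rightarrow> 'a \<Rightarrow> 'a" (infixl "\<oplus>" 65)
    and zero :: 'a
    and neg :: "'a \<Rightarrow> 'a"
    and gyr :: "'a \<Rightarrow> 'a \<Rightarrow> 'a \<Rightarrow> 'a"
  assumes add_closed: "\<lbrakk>x \<in> G; y \<in> G\<rbrakk> \<Longrightarrow> x \<oplus> y \<in> G"
    and zero_closed: "zero \<in> G"
    and zero_left: "a \<in> G \<Longrightarrow> zero \<oplus> a = a"
    and zero_right: "a \<in> G \<Longrightarrow> a \<oplus> zero = a"
    and zero_unique: "\<lbrakk>e \<in> G; \<And>a. a \<in> G \<Longrightarrow> e \<oplus> a = a \<and> a \<oplus> e = a\<rbrakk> \<Longrightarrow> e = zero"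
    and neg_closed: "x \<in> G \<Longrightarrow> neg x \<in> G"
    and neg_left: "x \<in> G \<Longrightarrow> neg x \<oplus> x = zero"
    and neg_right: "x \<in> G \<Longrightarrow> x \<oplus> neg x = zero"
    and neg_unique: "\<lbrakk>x \<in> G; y \<in> G; y \<oplus> x = zero; x \<oplus> y = zero\<rbrakk> \<Longrightarrow> y = neg x"
    and gyr_bij: "\<lbrakk>x \<in> G; y \<in> G\<rbrakk> \<Longrightarrow> bij_betw (gyr x y) G G"
    and gyr_add: "\<lbrakk>x \<in> G; y \<in> G; a \<in> G; b \<in> G\<rbrakk>
      \<Longrightarrow> gyr x y (a \<oplus> b) = gyr x y a \<oplus> gyr x y b"
    and gyr_assoc: "\<lbrakk>x \<in> G; y \<in> G; z \<in> G\<rbrakk>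
      \<Longrightarrow> x \<oplus> (y \<oplus> z) = (x \<oplus> y) \<oplus> gyr x y z"
    and gyr_loop: "\<lbrakk>x \<in> G; y \<in> G; z \<in> G\<rbrakk> \<Longrightarrow> gyr (x \<oplus> y) y z = gyr x y z"

(* No separation axiom is built in. *)
locale topological_gyrogroup =
  fixes X :: "'a topology"
    and add :: "'a \<Rightarrow> 'a \<Rightarrow> 'a" (infixl "\<oplus>" 65)
    and zero :: 'a
    and neg :: "'a \<Rightarrow> 'a"
    and gyr :: "'a \<Rightarrow> 'a \<Rightarrow> 'a \<Rightarrow> 'a"
  assumes gyrogroup: "gyrogroup (topspace X) add zero neg gyr"
    and continuous_add: "continuous_map (prod_topology X X) X (\<lambda>(x, y). x \<oplus> y)"
    and continuous_neg: "continuous_map X X neg"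

definition dense_in_itself :: "'a topology \<Rightarrow> bool" where
  "dense_in_itself X \<longleftrightarrow> (\<forall>x \<in> topspace X. \<not> openin X {x})"

definition submaximal_space :: "'a topology \<Rightarrow> bool" where
  "submaximal_space X \<longleftrightarrow>
    (\<forall>D \<subseteq> topspace X. X closure_of D = topspace X \<longrightarrow> openin X D)"

definition strongly_sigma_discrete :: "'a topology \<Rightarrow> bool" where
  "strongly_sigma_discrete X \<longleftrightarrow>
    (\<exists>\<F>. countable \<F> \<and> \<Union>\<F> = topspace X \<and>
      (\<forall>S \<in> \<F>. closedin X S \<and> subtopology X S = discrete_topology S))"

(* The property depends only on the cardinality of A, so it is stated for A itself.
   Two-valued means with values in {0, 1}; in particular the value infinity is excluded. *)
definition nonmeasurable_cardinality :: "'a set \<Rightarrow> bool" where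
  "nonmeasurable_cardinality A \<longleftrightarrow>
    (\<forall>M. space M = A \<and> sets M = Pow A \<and>
         (\<forall>S \<in> Pow A. emeasure M S \<in> {0, 1}) \<and> (\<forall>x \<in> A. emeasure M {x} = 0)
       \<longrightarrow> (\<forall>S \<in> Pow A. emeasure M S = 0))"

end

theory Submission
  imports Defs
begin

text \<open>
  The algebra enters only through homogeneity: left translations are homeomorphisms, so the
  group of homeomorphisms acts transitively (\<open>topological_gyrogroup_homogeneous\<close>). The rest is a
  statement about homogeneous crowded submaximal spaces.

  In a submaximal space a set with empty interior is closed and discrete, because the complement
  of each of its subsets is dense. Hence it suffices to cover \<open>X\<close> by countably many sets with
  empty interior. Suppose that this is impossible. By homogeneity and the Banach category
  argument (\<open>homogeneous_sigma_codense_open\<close>) no nonempty open set has such a cover either, so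
  the sets with empty interior form a \<open>\<sigma>\<close>-ideal \<open>I\<close>, which contains the points. From \<open>I\<close> a
  nonzero two-valued measure is manufactured, against the hypothesis on the cardinality.

  The ideal \<open>I\<close> itself need not be prime, so one pushes it forward along a suitable map \<open>\<zeta>\<close>. Choose homeomorphisms \<open>h a b\<close> taking \<open>a\<close> to \<open>b\<close>, with \<open>h b a\<close> inverse to \<open>h a b\<close>.
  Let \<open>A\<close> be a set of least cardinality outside \<open>I\<close>. Closing the initial segments of a
  well-ordering of \<open>A\<close> of least type under \<open>h\<close> gives a chain of sets that are
  too small to lie outside \<open>I\<close>, while their union \<open>Y\<close>
  contains \<open>A\<close>. Label a point \<open>y\<close> of \<open>Y\<close> by its orbit under the maps \<open>h a b\<close> whose parameters
  occur in the chain before \<open>y\<close> (\<open>chain_orbit_labelling\<close>). Each label class lies in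
  one member of the chain, hence in \<open>I\<close>; and each single map \<open>h a b\<close> with parameters in \<open>Y\<close>
  preserves labels off one member of the chain.

  This makes the pushed-forward ideal prime. If a union of label classes and its complement in
  \<open>Y\<close> both had interior points, say \<open>a\<close> and \<open>b\<close>, then \<open>h a b\<close> would map a neighbourhood of \<open>a\<close>
  from the one set into the other. That neighbourhood is not contained in a member of the chain,
  so \<open>h a b\<close> would change the label of a point whose label it preserves.
\<close>

unbundle cardinal_syntax

section \<open>Sets with empty interior\<close>

definition codense :: "'a topology \<Rightarrow> 'a set \<Rightarrow> bool" where
  "codense X A \<longleftrightarrow> A \<subseteq> topspace X \<and> (\<forall>U. openin X U \<and> U \<subseteq> A \<longrightarrow> U = {})"

definition sigma_codense :: "'a topology \<Rightarrow> 'a set \<Rightarrow> bool" where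
  "sigma_codense X A \<longleftrightarrow> (\<exists>F :: nat \<Rightarrow> 'a set. (\<forall>n. codense X (F n)) \<and> A = (\<Union>n. F n))"

lemma codense_subset: "codense X A \<Longrightarrow> B \<subseteq> A \<Longrightarrow> codense X B"
  unfolding codense_def by blast

lemma codense_empty: "codense X {}"
  unfolding codense_def by blast

lemma codense_singleton:
  assumes "dense_in_itself X" "x \<in> topspace X"
  shows "codense X {x}"
  using assms unfolding codense_def dense_in_itself_def by (metis bot.extremum insert_subset subset_singletonD)

lemma not_codenseE:
  assumes "\<not> codense X A" "A \<subseteq> topspace X"
  obtains U where "openin X U" "U \<subseteq> A" "U \<noteq> {}"
  using assms unfolding codense_def by blast

lemma sigma_codense_subset:
  assumes "sigma_codense X A" "B \<subseteq> A"
  shows "sigma_codense X B"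
proof -
  obtain F :: "nat \<Rightarrow> 'a set" where F: "\<And>n. codense X (F n)" "A = (\<Union>n. F n)"
    using assms unfolding sigma_codense_def by blast
  have "B = (\<Union>n. F n \<inter> B)" "\<And>n. codense X (F n \<inter> B)"
    using assms F(2) by (auto intro: codense_subset[OF F(1)])
  then show ?thesis unfolding sigma_codense_def by (intro exI[of _ "\<lambda>n. F n \<inter> B"]) simp
qed

lemma codense_homeomorphic_image:
  assumes f: "homeomorphic_maps X X f g" and A: "codense X A"
  shows "codense X (f ` A)"
  unfolding codense_def
proof (intro conjI allI impI)
  have sub: "A \<subseteq> topspace X" using A unfolding codense_def by blast
  have map: "homeomorphic_map X X f" "homeomorphic_map X X g"
    and inv: "\<And>x. x \<in> topspace X \<Longrightarrow> g (f x) = x"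
    using f by (auto simp: homeomorphic_maps_map)
  show "f ` A \<subseteq> topspace X"
    using homeomorphic_imp_surjective_map[OF map(1)] sub by blast
  fix U assume U: "openin X U \<and> U \<subseteq> f ` A"
  have "openin X (g ` U)"
    using homeomorphic_imp_open_map[OF map(2)] U unfolding open_map_def by blast
  moreover have "g ` U \<subseteq> A"
  proof
    fix y assume "y \<in> g ` U"
    then obtain a where "a \<in> A" "y = g (f a)" using U by blast
    then show "y \<in> A" using inv sub by auto
  qed
  ultimately have "g ` U = {}" using A unfolding codense_def by blast
  then show "U = {}" by blast
qed

lemma sigma_codense_homeomorphic_image:
  assumes f: "homeomorphic_maps X X f g" and A: "sigma_codense X A"
  shows "sigma_codense X (f ` A)"
proof -
  obtain F :: "nat \<Rightarrow> 'a set" where F: "\<And>n. codense X (F n)" "A = (\<Union>n. F n)"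
    using A unfolding sigma_codense_def by blast
  show ?thesis unfolding sigma_codense_def
    by (intro exI[of _ "\<lambda>n. f ` F n"] conjI allI codense_homeomorphic_image[OF f F(1)])
      (simp add: F(2) image_UN)
qed

lemma submaximal_codense_openin_diff:
  assumes X: "submaximal_space X" and A: "codense X A"
  shows "openin X (topspace X - A)"
proof -
  have "X interior_of A = {}"
    using A unfolding codense_def by (meson interior_of_subset openin_interior_of)
  then have "X closure_of (topspace X - A) = topspace X"
    by (simp add: closure_of_complement)
  then show ?thesis using X unfolding submaximal_space_def by blast
qed

text \<open>
  All subsets of a set with empty interior have dense, hence open, complements; so all of them
  are closed in the whole space.
\<close>
lemma submaximal_codense_closed_discrete:
  assumes X: "submaximal_space X" and A: "codense X A"
  shows "closedin X A" "subtopology X A = discrete_topology A"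
proof -
  have sub: "A \<subseteq> topspace X" using A unfolding codense_def by blast
  have op: "openin X (topspace X - B)" if "B \<subseteq> A" for B
    by (rule submaximal_codense_openin_diff[OF X codense_subset[OF A that]])
  show "closedin X A" using op[of A] sub by (simp add: closedin_def)
  have "openin (subtopology X A) {x}" if "x \<in> A" for x
  proof -
    have "{x} = (topspace X - (A - {x})) \<inter> A" using that sub by blast
    then show ?thesis using op[of "A - {x}"] unfolding openin_subtopology by blast
  qed
  then show "subtopology X A = discrete_topology A"
    using sub discrete_topology_unique[of A "subtopology X A"] by auto
qed

lemma submaximal_sigma_codense_imp_strongly_sigma_discrete:
  assumes "submaximal_space X" "sigma_codense X (topspace X)"
  shows "strongly_sigma_discrete X"
proof -
  obtain F :: "nat \<Rightarrow> 'a set" where F: "\<And>n. codense X (F n)" "topspace X = (\<Union>n. F n)"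
    using assms unfolding sigma_codense_def by blast
  show ?thesis unfolding strongly_sigma_discrete_def
    using submaximal_codense_closed_discrete[OF assms(1) F(1)] F(2)
    by (intro exI[of _ "range F"]) auto
qed

section \<open>Homogeneity\<close>

definition homogeneous_topology :: "'a topology \<Rightarrow> bool" where
  "homogeneous_topology X \<longleftrightarrow>
    (\<forall>x \<in> topspace X. \<forall>y \<in> topspace X. \<exists>f. homeomorphic_map X X f \<and> f x = y)"

text \<open>
  The transport maps can be chosen coherently: fix a base point \<open>e\<close>, choose for each \<open>a\<close> one
  homeomorphism taking \<open>e\<close> to \<open>a\<close>, and go from \<open>a\<close> to \<open>b\<close> through \<open>e\<close>. This is what makes
  \<open>h b a\<close> the inverse of \<open>h a b\<close>, so that sets closed under \<open>h\<close> are closed under inverses too.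
\<close>
lemma homogeneous_transport:
  assumes "homogeneous_topology X"
  obtains h where
    "\<And>a b. \<lbrakk>a \<in> topspace X; b \<in> topspace X\<rbrakk> \<Longrightarrow> homeomorphic_maps X X (h a b) (h b a)"
    "\<And>a b. \<lbrakk>a \<in> topspace X; b \<in> topspace X\<rbrakk> \<Longrightarrow> h a b a = b"
proof (cases "topspace X = {}")
  case True
  show ?thesis by (rule that[of undefined]) (use True in auto)
next
  case False
  then obtain e where e: "e \<in> topspace X" by blast
  have "\<exists>f g. homeomorphic_maps X X f g \<and> f e = a" if "a \<in> topspace X" for a
    using assms e that unfolding homogeneous_topology_def homeomorphic_map_maps by blast
  then obtain f g where fg: "\<And>a. a \<in> topspace X \<Longrightarrow> homeomorphic_maps X X (f a) (g a)"
    and fe: "\<And>a. a \<in> topspace X \<Longrightarrow> f a e = a" by metis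
  show ?thesis
  proof (rule that[of "\<lambda>a b. f b \<circ> g a"])
    fix a b assume ab: "a \<in> topspace X" "b \<in> topspace X"
    show "homeomorphic_maps X X (f b \<circ> g a) (f a \<circ> g b)"
      using homeomorphic_maps_compose fg[OF ab(2)] fg[OF ab(1)] homeomorphic_maps_sym by metis
    have "g a (f a e) = e" using fg[OF ab(1)] e unfolding homeomorphic_maps_def by blast
    then show "(f b \<circ> g a) a = b" using fe ab by simp
  qed
qed

text \<open>
  The Banach category argument, for sets with empty interior. Translates of \<open>W\<close> put
  \<open>\<sigma>\<close>-codense open sets inside every nonempty open set, so a maximal disjoint family of
  \<open>\<sigma>\<close>-codense open sets has a dense union. Disjointness allows the \<open>n\<close>-th pieces of its members
  to be merged into one set that still has empty interior.
\<close>
lemma homogeneous_sigma_codense_open: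
  assumes hom: "homogeneous_topology X"
    and W: "openin X W" "W \<noteq> {}" "sigma_codense X W"
  shows "sigma_codense X (topspace X)"
proof -
  obtain h where h: "\<And>a b. \<lbrakk>a \<in> topspace X; b \<in> topspace X\<rbrakk> \<Longrightarrow> homeomorphic_maps X X (h a b) (h b a)"
    "\<And>a b. \<lbrakk>a \<in> topspace X; b \<in> topspace X\<rbrakk> \<Longrightarrow> h a b a = b"
    using homogeneous_transport[OF hom] by metis
  obtain w where w: "w \<in> W" using W by blast
  then have wX: "w \<in> topspace X" using W openin_subset by blast
  have local: "\<exists>V. openin X V \<and> V \<noteq> {} \<and> V \<subseteq> U \<and> sigma_codense X V"
    if U: "openin X U" "U \<noteq> {}" for U
  proof -
    obtain u where u: "u \<in> U" using U by blast
    then have uX: "u \<in> topspace X" using U openin_subset by blast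
    let ?V = "U \<inter> h w u ` W"
    have "openin X (h w u ` W)"
      using h(1)[OF wX uX] W homeomorphic_imp_open_map unfolding homeomorphic_maps_map open_map_def
      by blast
    moreover have "u \<in> ?V" using h(2)[OF wX uX] w u by force
    moreover have "sigma_codense X ?V"
      using sigma_codense_subset[OF sigma_codense_homeomorphic_image[OF h(1)[OF wX uX] W(3)]] by blast
    ultimately show ?thesis using U by blast
  qed
  define \<A> where "\<A> = {\<V>. disjoint \<V> \<and> (\<forall>V \<in> \<V>. openin X V \<and> V \<noteq> {} \<and> sigma_codense X V)}"
  have "\<exists>M\<in>\<A>. \<forall>\<V>\<in>\<A>. M \<subseteq> \<V> \<longrightarrow> \<V> = M"
  proof (rule subset_Zorn')
    fix \<C> assume C: "subset.chain \<A> \<C>"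
    have "disjoint (\<Union>\<C>)"
      unfolding disjoint_def
    proof (intro ballI impI)
      fix V V' assume V: "V \<in> \<Union>\<C>" "V' \<in> \<Union>\<C>" "V \<noteq> V'"
      then obtain c where "c \<in> \<C>" "V \<in> c" "V' \<in> c"
        using C unfolding subset_chain_def by blast
      then show "V \<inter> V' = {}"
        using C V(3) unfolding subset_chain_def \<A>_def disjoint_def by blast
    qed
    then show "\<Union>\<C> \<in> \<A>"
      using C unfolding subset_chain_def \<A>_def by blast
  qed
  then obtain \<V> where VA: "\<V> \<in> \<A>" and max: "\<And>\<V>'. \<V>' \<in> \<A> \<Longrightarrow> \<V> \<subseteq> \<V>' \<Longrightarrow> \<V>' = \<V>"
    by blast
  have disj: "disjoint \<V>" and V: "\<And>V. V \<in> \<V> \<Longrightarrow> openin X V \<and> V \<noteq> {} \<and> sigma_codense X V"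
    using VA unfolding \<A>_def by auto
  have meets: "\<exists>V\<in>\<V>. U \<inter> V \<noteq> {}" if U: "openin X U" "U \<noteq> {}" for U
  proof (rule ccontr)
    assume no: "\<not> ?thesis"
    obtain O' where O': "openin X O'" "O' \<noteq> {}" "O' \<subseteq> U" "sigma_codense X O'"
      using local[OF U] by blast
    have "O' \<inter> V = {}" if "V \<in> \<V>" for V using no that O'(3) by blast
    then have "disjoint (insert O' \<V>)"
      using disj by (simp add: pairwise_insert disjnt_def Int_commute)
    then have "insert O' \<V> \<in> \<A>"
      using V O' unfolding \<A>_def by simp
    then have "O' \<in> \<V>" using max by blast
    then show False using no O' by blast
  qed
  have "\<exists>F :: nat \<Rightarrow> 'a set. (\<forall>n. codense X (F n)) \<and> V = (\<Union>n. F n)" if "V \<in> \<V>" for V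
    using V[OF that] unfolding sigma_codense_def by blast
  then obtain F :: "'a set \<Rightarrow> nat \<Rightarrow> 'a set" where F: "\<And>V n. V \<in> \<V> \<Longrightarrow> codense X (F V n)"
    "\<And>V. V \<in> \<V> \<Longrightarrow> V = (\<Union>n. F V n)" by metis
  define N where "N n = (\<Union>V\<in>\<V>. F V n)" for n
  have Nsub: "N n \<subseteq> topspace X" for n using F(1) unfolding N_def codense_def by blast
  have N: "codense X (N n)" for n
    unfolding codense_def
  proof (intro conjI allI impI)
    show "N n \<subseteq> topspace X" by (rule Nsub)
    fix U assume U: "openin X U \<and> U \<subseteq> N n"
    show "U = {}"
    proof (rule ccontr)
      assume "U \<noteq> {}"
      then obtain V where V': "V \<in> \<V>" "U \<inter> V \<noteq> {}" using meets U by blast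
      have "U \<inter> V \<subseteq> F V n"
      proof
        fix x assume x: "x \<in> U \<inter> V"
        then obtain V2 where V2: "V2 \<in> \<V>" "x \<in> F V2 n" using U unfolding N_def by blast
        then have "x \<in> V2" using F(2) by blast
        then have "V2 = V" using disj x V2(1) V'(1) unfolding disjoint_def by blast
        then show "x \<in> F V n" using V2 by blast
      qed
      moreover have "openin X (U \<inter> V)" using U V V'(1) by blast
      ultimately show False using F(1)[OF V'(1)] V'(2) unfolding codense_def by blast
    qed
  qed
  have rest: "codense X (topspace X - \<Union>\<V>)"
    unfolding codense_def using meets by blast
  have "topspace X = (\<Union>n. case n of 0 \<Rightarrow> topspace X - \<Union>\<V> | Suc m \<Rightarrow> N m)" (is "_ = (\<Union>n. ?G n)")
  proof
    show "topspace X \<subseteq> (\<Union>n. ?G n)"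
    proof
      fix x assume x: "x \<in> topspace X"
      show "x \<in> (\<Union>n. ?G n)"
      proof (cases "x \<in> \<Union>\<V>")
        case True
        then obtain V n where "V \<in> \<V>" "x \<in> F V n" using F(2) by blast
        then have "x \<in> ?G (Suc n)" unfolding N_def by auto
        then show ?thesis by blast
      next
        case False
        then have "x \<in> ?G 0" using x by simp
        then show ?thesis by blast
      qed
    qed
    show "(\<Union>n. ?G n) \<subseteq> topspace X"
      using Nsub by (force split: nat.splits)
  qed
  moreover have "codense X (?G n)" for n using N rest by (simp split: nat.split)
  ultimately show ?thesis unfolding sigma_codense_def
    by (intro exI[of _ "\<lambda>n. ?G n"]) blast
qed

section \<open>Closing a set under a ternary operation\<close>

inductive_set ternary_hull :: "('a \<Rightarrow> 'a \<Rightarrow> 'a \<Rightarrow> 'a) \<Rightarrow> 'a set \<Rightarrow> 'a set"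
  for h :: "'a \<Rightarrow> 'a \<Rightarrow> 'a \<Rightarrow> 'a" and B :: "'a set" where
  base: "b \<in> B \<Longrightarrow> b \<in> ternary_hull h B"
| step: "\<lbrakk>a \<in> ternary_hull h B; b \<in> ternary_hull h B; c \<in> ternary_hull h B\<rbrakk>
    \<Longrightarrow> h a b c \<in> ternary_hull h B"

lemma ternary_hull_mono:
  assumes "B \<subseteq> B'"
  shows "ternary_hull h B \<subseteq> ternary_hull h B'"
proof
  fix x assume "x \<in> ternary_hull h B"
  then show "x \<in> ternary_hull h B'"
    by induction (use assms in \<open>auto intro: ternary_hull.intros\<close>)
qed

text \<open>
  The bound is an arbitrary infinite set \<open>K\<close>, so that the natural numbers can serve for the hull of
  a finite set.
\<close>
lemma card_of_ternary_hull:
  assumes inf: "infinite K" and B: "|B| \<le>o |K|"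
  shows "|ternary_hull h B| \<le>o |K|"
proof -
  define stage where "stage n = ((\<lambda>S. S \<union> (\<lambda>(a, b, c). h a b c) ` (S \<times> S \<times> S)) ^^ n) B" for n :: nat
  have stage_Suc: "stage (Suc n) = stage n \<union> (\<lambda>(a, b, c). h a b c) ` (stage n \<times> stage n \<times> stage n)" for n
    unfolding stage_def by simp
  have card: "|stage n| \<le>o |K|" for n
  proof (induction n)
    case 0
    show ?case using B unfolding stage_def by simp
  next
    case (Suc n)
    have "|stage n \<times> stage n \<times> stage n| \<le>o |K|"
      using Suc inf by (intro card_of_Times_ordLeq_infinite_Field card_of_Card_order) (auto simp: Field_card_of)
    then have "|(\<lambda>(a, b, c). h a b c) ` (stage n \<times> stage n \<times> stage n)| \<le>o |K|"
      using card_of_image ordLeq_transitive by blast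
    then show ?case unfolding stage_Suc 
      using Suc inf by (intro card_of_Un_ordLeq_infinite_Field card_of_Card_order) (auto simp: Field_card_of)
  qed
  have mono: "stage m \<subseteq> stage n" if "m \<le> n" for m n
    using that by (rule lift_Suc_mono_le[rotated]) (auto simp: stage_Suc)
  have "ternary_hull h B \<subseteq> (\<Union>n. stage n)"
  proof
    fix x assume "x \<in> ternary_hull h B"
    then show "x \<in> (\<Union>n. stage n)"
    proof induction
      case (base b)
      then have "b \<in> stage 0" unfolding stage_def by simp
      then show ?case by blast
    next
      case (step a b c)
      then obtain i j k where "a \<in> stage i" "b \<in> stage j" "c \<in> stage k" by blast
      then have "a \<in> stage (max i (max j k))" "b \<in> stage (max i (max j k))" "c \<in> stage (max i (max j k))"
        using mono by (meson max.cobounded1 max.cobounded2 order_trans subsetD)+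
      then have "h a b c \<in> stage (Suc (max i (max j k)))"
        unfolding stage_Suc by force
      then show ?case by blast
    qed
  qed
  moreover have "|\<Union>n\<in>UNIV. stage n| \<le>o |K|"
    using card_of_UNION_ordLeq_infinite[OF inf, of "UNIV :: nat set" stage] card inf
    by (simp add: infinite_iff_card_of_nat)
  ultimately show ?thesis using card_of_mono1 ordLeq_transitive by blast
qed

section \<open>Orbits along a chain\<close>

text \<open>
  The label of \<open>y\<close> is a representative of its orbit under the maps \<open>h a b\<close> with \<open>a\<close> and \<open>b\<close> in
  \<open>D y\<close>, the union of the members of the chain that miss \<open>y\<close>. These maps are
  invertible on every member of the chain that contains \<open>y\<close>, as well as on \<open>D y\<close>. So they move
  \<open>y\<close> neither into an earlier nor into a later member, and they leave \<open>D y\<close> unchanged. Thus the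
  orbits are well defined, and a map with parameters in \<open>C\<close> respects them on the complement
  of \<open>C\<close>.
\<close>
lemma chain_orbit_labelling:
  assumes chain: "\<And>C D. C \<in> \<C> \<Longrightarrow> D \<in> \<C> \<Longrightarrow> C \<subseteq> D \<or> D \<subseteq> C"
    and closed: "\<And>C a b c. \<lbrakk>C \<in> \<C>; a \<in> C; b \<in> C; c \<in> C\<rbrakk> \<Longrightarrow> h a b c \<in> C"
    and inv: "\<And>a b c. \<lbrakk>a \<in> \<Union>\<C>; b \<in> \<Union>\<C>; c \<in> \<Union>\<C>\<rbrakk> \<Longrightarrow> h b a (h a b c) = c"
  obtains \<zeta> where
    "\<And>C a b y. \<lbrakk>C \<in> \<C>; a \<in> C; b \<in> C; y \<in> \<Union>\<C> - C\<rbrakk> \<Longrightarrow> \<zeta> (h a b y) = \<zeta> y"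
    "\<And>y. y \<in> \<Union>\<C> \<Longrightarrow> \<exists>C\<in>\<C>. {z \<in> \<Union>\<C>. \<zeta> z = \<zeta> y} \<subseteq> C"
    "\<And>y. y \<in> \<Union>\<C> \<Longrightarrow> \<zeta> y \<in> \<Union>\<C>"
proof -
  define D where "D y = \<Union>{C \<in> \<C>. y \<notin> C}" for y
  define R where "R y = {(u, h a b u) | u a b. a \<in> D y \<and> b \<in> D y \<and> u \<in> \<Union>\<C>}" for y
  define orb where "orb y = {z. (y, z) \<in> (R y)\<^sup>*}" for y
  define \<zeta> where "\<zeta> y = (SOME z. z \<in> orb y)" for y
  have notin_D: "y \<notin> D y" for y unfolding D_def by blast
  have D_sub: "D y \<subseteq> \<Union>\<C>" for y unfolding D_def by blast
  have D_sub_C: "D y \<subseteq> C" if "C \<in> \<C>" "y \<in> C" for y C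
    unfolding D_def using that chain by blast
  have D_common: "\<exists>C\<in>\<C>. y \<notin> C \<and> a \<in> C \<and> b \<in> C \<and> c \<in> C"
    if abc: "a \<in> D y" "b \<in> D y" "c \<in> D y" for a b c y
  proof -
    obtain A where A: "A \<in> \<C>" "y \<notin> A" "a \<in> A" using abc(1) unfolding D_def by blast
    obtain B where B: "B \<in> \<C>" "y \<notin> B" "b \<in> B" using abc(2) unfolding D_def by blast
    obtain C where C: "C \<in> \<C>" "y \<notin> C" "c \<in> C" using abc(3) unfolding D_def by blast
    consider "A \<subseteq> B" "B \<subseteq> C" | "A \<subseteq> B" "C \<subseteq> B" | "B \<subseteq> A" "A \<subseteq> C" | "B \<subseteq> A" "C \<subseteq> A"
      using chain[OF A(1) B(1)] chain[OF A(1) C(1)] chain[OF B(1) C(1)] by argo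
    then show ?thesis
    proof cases
      case 1
      then show ?thesis using A B C by (intro bexI[of _ C]) auto
    next
      case 2
      then show ?thesis using A B C by (intro bexI[of _ B]) auto
    next
      case 3
      then show ?thesis using A B C by (intro bexI[of _ C]) auto
    next
      case 4
      then show ?thesis using A B C by (intro bexI[of _ A]) auto
    qed
  qed
  have D_closed: "h a b c \<in> D y" if abc: "a \<in> D y" "b \<in> D y" "c \<in> D y" for a b c y
  proof -
    obtain C where C: "C \<in> \<C>" "y \<notin> C" "a \<in> C" "b \<in> C" "c \<in> C"
      using D_common[OF abc] by blast
    then have "h a b c \<in> C" by (intro closed)
    then show ?thesis unfolding D_def using C by blast
  qed
  have in_Union: "h a b y \<in> \<Union>\<C>" if y: "y \<in> \<Union>\<C>" and ab: "a \<in> D y" "b \<in> D y" for a b y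
    using y ab closed D_sub_C by blast
  have D_step: "D (h a b y) = D y" if y: "y \<in> \<Union>\<C>" and ab: "a \<in> D y" "b \<in> D y" for a b y
  proof -
    have same: "y \<in> C \<longleftrightarrow> h a b y \<in> C" if C: "C \<in> \<C>" for C
    proof
      show "h a b y \<in> C" if "y \<in> C" using closed[OF C] D_sub_C[OF C that] ab that by blast
      show "y \<in> C" if hC: "h a b y \<in> C"
      proof (rule ccontr)
        assume "y \<notin> C"
        then have "h a b y \<in> D y" using C hC unfolding D_def by blast
        then have "h b a (h a b y) \<in> D y" using D_closed ab by blast
        moreover have "h b a (h a b y) = y" using inv y ab D_sub by blast
        ultimately show False using notin_D by simp
      qed
    qed
    have "{C \<in> \<C>. h a b y \<notin> C} = {C \<in> \<C>. y \<notin> C}" using same by (intro Collect_cong) auto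
    then show ?thesis unfolding D_def by (rule arg_cong)
  qed
  have orb_step: "orb (h a b y) = orb y" if y: "y \<in> \<Union>\<C>" and ab: "a \<in> D y" "b \<in> D y" for a b y
  proof -
    have R: "R (h a b y) = R y" unfolding R_def using D_step[OF y ab] by simp
    have 1: "(y, h a b y) \<in> R y" unfolding R_def using y ab by blast
    have "h b a (h a b y) = y" using inv y ab D_sub by blast
    then have "(h a b y, y) = (h a b y, h b a (h a b y))" by simp
    then have 2: "(h a b y, y) \<in> R y" unfolding R_def using in_Union[OF y ab] ab by blast
    show ?thesis unfolding orb_def R using 1 2 by (blast intro: converse_rtrancl_into_rtrancl)
  qed
  have orb_sub: "orb y \<subseteq> C" if C: "C \<in> \<C>" "y \<in> C" for y C
  proof
    fix z assume "z \<in> orb y"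
    then have "(y, z) \<in> (R y)\<^sup>*" unfolding orb_def by blast
    then show "z \<in> C"
      by induction (use C closed[OF C(1)] D_sub_C[OF C] in \<open>auto simp: R_def\<close>)
  qed
  \<comment> \<open>Inverses \<open>h b a\<close> would carry a point of \<open>D y\<close> on the orbit back to \<open>y\<close> within \<open>D y\<close>.\<close>
  have orb_avoids: "z \<notin> D y" if "z \<in> orb y" for y z
  proof -
    have "(y, z) \<in> (R y)\<^sup>*" using that unfolding orb_def by blast
    then show ?thesis
    proof induction
      case base
      show ?case by (rule notin_D)
    next
      case (step u v)
      then obtain a b where ab: "a \<in> D y" "b \<in> D y" "u \<in> \<Union>\<C>" "v = h a b u"
        unfolding R_def by blast
      have "h b a v = u" using inv ab D_sub by blast
      then show ?case using D_closed[OF ab(2,1), of v] step.IH by auto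
    qed
  qed
  have \<zeta>_in: "\<zeta> y \<in> orb y" for y
    unfolding \<zeta>_def by (rule someI[of _ y]) (simp add: orb_def)
  show ?thesis
  proof (rule that[of \<zeta>])
    fix C a b y assume C: "C \<in> \<C>" "a \<in> C" "b \<in> C" "y \<in> \<Union>\<C> - C"
    then have "a \<in> D y" "b \<in> D y" unfolding D_def by auto
    then have "orb (h a b y) = orb y" using orb_step C(4) by blast
    then show "\<zeta> (h a b y) = \<zeta> y" unfolding \<zeta>_def by simp
  next
    fix y assume "y \<in> \<Union>\<C>"
    then obtain C where C: "C \<in> \<C>" "y \<in> C" by blast
    have "z \<in> C" if z: "z \<in> \<Union>\<C>" "\<zeta> z = \<zeta> y" for z
    proof (rule ccontr)
      assume "z \<notin> C"
      then have "C \<subseteq> D z" unfolding D_def using C by blast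
      then have "\<zeta> z \<in> D z" using \<zeta>_in[of y] orb_sub[OF C] z(2) by auto
      then show False using orb_avoids[OF \<zeta>_in] by blast
    qed
    then show "\<exists>C\<in>\<C>. {z \<in> \<Union>\<C>. \<zeta> z = \<zeta> y} \<subseteq> C" using C(1) by blast
  next
    fix y assume "y \<in> \<Union>\<C>"
    then show "\<zeta> y \<in> \<Union>\<C>" using \<zeta>_in[of y] orb_sub by blast
  qed
qed

section \<open>Two-valued measures\<close>

text \<open>
  The complement of a prime \<open>\<sigma>\<close>-ideal is the family of sets of measure one for a two-valued measure:
  two disjoint sets cannot both lie outside the ideal, so at most one term of a disjoint
  sum is nonzero.
\<close>
lemma nonmeasurable_cardinality_prime_ideal:
  fixes N :: "'a set \<Rightarrow> bool"
  assumes S: "nonmeasurable_cardinality S"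
    and sub: "\<And>A B. \<lbrakk>N A; B \<subseteq> A; A \<subseteq> S\<rbrakk> \<Longrightarrow> N B"
    and count: "\<And>A :: nat \<Rightarrow> 'a set. \<lbrakk>\<And>n. N (A n); \<And>n. A n \<subseteq> S\<rbrakk> \<Longrightarrow> N (\<Union>n. A n)"
    and sing: "\<And>x. x \<in> S \<Longrightarrow> N {x}"
    and empty: "N {}"
    and prime: "\<And>A. A \<subseteq> S \<Longrightarrow> N A \<or> N (S - A)"
  shows "N S"
proof -
  define \<mu> where "\<mu> A = (if N A then 0 else 1 :: ennreal)" for A
  define M where "M = measure_of S (Pow S) \<mu>"
  have "countably_additive (Pow S) \<mu>"
    unfolding countably_additive_def
  proof (intro allI impI)
    fix A :: "nat \<Rightarrow> 'a set"
    assume A: "range A \<subseteq> Pow S" "disjoint_family A" "\<Union> (range A) \<in> Pow S"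
    show "(\<Sum>i. \<mu> (A i)) = \<mu> (\<Union> (range A))"
    proof (cases "\<forall>n. N (A n)")
      case True
      then have "N (\<Union> (range A))" using count[of A] A by blast
      then show ?thesis using True by (simp add: \<mu>_def)
    next
      case False
      then obtain k where k: "\<not> N (A k)" by blast
      have Ak: "A k \<subseteq> S" using A by blast
      have "N (A i)" if "i \<noteq> k" for i
      proof (rule sub)
        show "N (S - A k)" using prime[OF Ak] k by blast
        show "A i \<subseteq> S - A k" using A that unfolding disjoint_family_on_def by blast
      qed auto
      then have "\<mu> (A i) = (if i = k then 1 else 0)" for i using k by (simp add: \<mu>_def)
      moreover have "(\<lambda>i. if i = k then 1 else 0 :: ennreal) sums 1" by (rule sums_single)
      ultimately have "(\<Sum>i. \<mu> (A i)) = 1" by (simp add: sums_iff)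
      moreover have "\<not> N (\<Union> (range A))" using sub[of "\<Union> (range A)" "A k"] k A by blast
      ultimately show ?thesis by (simp add: \<mu>_def)
    qed
  qed
  moreover have "positive (Pow S) \<mu>" by (simp add: positive_def \<mu>_def empty)
  ultimately have em: "emeasure M A = \<mu> A" if "A \<subseteq> S" for A
    unfolding M_def using that emeasure_measure_of_sigma[OF sigma_algebra_Pow] by blast
  have "space M = S" "sets M = Pow S" unfolding M_def by (simp_all add: sigma_algebra.sigma_sets_eq[OF sigma_algebra_Pow])
  moreover have "\<forall>A\<in>Pow S. emeasure M A \<in> {0, 1}" "\<forall>x\<in>S. emeasure M {x} = 0"
    using em sing by (auto simp: \<mu>_def)
  ultimately have "emeasure M S = 0"
    using S unfolding nonmeasurable_cardinality_def by blast
  then show "N S" using em[of S] by (simp add: \<mu>_def split: if_splits)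
qed

section \<open>Homogeneous submaximal spaces\<close>

text \<open>
  Minimality of the cardinality of \<open>A\<close> is used to put the members \<open>C a\<close> of the chain into the ideal.
  For this \<open>A\<close> has to be uncountable, since the hull of a finite initial segment may be
  countably infinite; this holds because countable sets belong to a \<open>\<sigma>\<close>-ideal containing the points.
\<close>
theorem homogeneous_submaximal_strongly_sigma_discrete:
  assumes hom: "homogeneous_topology X" and crowded: "dense_in_itself X"
    and subm: "submaximal_space X" and nm: "nonmeasurable_cardinality (topspace X)"
  shows "strongly_sigma_discrete X"
proof (rule ccontr)
  assume "\<not> strongly_sigma_discrete X"
  then have not_sigma: "\<not> sigma_codense X (topspace X)"
    using submaximal_sigma_codense_imp_strongly_sigma_discrete[OF subm] by blast
  have codense_UN: "codense X (\<Union>n. F n)" if F: "\<And>n. codense X (F n)" for F :: "nat \<Rightarrow> 'a set"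
    unfolding codense_def
  proof (intro conjI allI impI)
    show "(\<Union>n. F n) \<subseteq> topspace X" using F unfolding codense_def by blast
    fix U assume U: "openin X U \<and> U \<subseteq> (\<Union>n. F n)"
    have "sigma_codense X (\<Union>n. F n)" unfolding sigma_codense_def using F by blast
    then have "sigma_codense X U" using sigma_codense_subset U by blast
    then show "U = {}" using homogeneous_sigma_codense_open[OF hom] U not_sigma by blast
  qed
  have codense_countable: "codense X B" if B: "B \<subseteq> topspace X" "countable B" for B
  proof (cases "B = {}")
    case True
    then show ?thesis by (simp add: codense_empty)
  next
    case False
    have "codense X {from_nat_into B n}" for n
      using codense_singleton[OF crowded] from_nat_into[OF False] B(1) by blast
    then have "codense X (\<Union>n. {from_nat_into B n})" by (rule codense_UN)
    moreover have "(\<Union>n. {from_nat_into B n}) = B"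
      using range_from_nat_into[OF False B(2)] by blast
    ultimately show ?thesis by simp
  qed
  have not_codense_top: "\<not> codense X (topspace X)"
    using codense_UN[of "\<lambda>_. topspace X"] not_sigma unfolding sigma_codense_def by auto
  obtain h where
    h: "\<And>a b. \<lbrakk>a \<in> topspace X; b \<in> topspace X\<rbrakk> \<Longrightarrow> homeomorphic_maps X X (h a b) (h b a)"
    and hab: "\<And>a b. \<lbrakk>a \<in> topspace X; b \<in> topspace X\<rbrakk> \<Longrightarrow> h a b a = b"
    using homogeneous_transport[OF hom] by metis
  have h_in: "h a b c \<in> topspace X" if "a \<in> topspace X" "b \<in> topspace X" "c \<in> topspace X" for a b c
    using h[OF that(1,2)] that(3) continuous_map_image_subset_topspace
    unfolding homeomorphic_maps_def by blast
  have h_inv: "h b a (h a b c) = c" if "a \<in> topspace X" "b \<in> topspace X" "c \<in> topspace X" for a b c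
    using h[OF that(1,2)] that(3) unfolding homeomorphic_maps_def by blast
  have "\<exists>r\<in>{|A| | A. A \<subseteq> topspace X \<and> \<not> codense X A}.
      \<forall>r'\<in>{|A| | A. A \<subseteq> topspace X \<and> \<not> codense X A}. r \<le>o r'"
    using not_codense_top by (intro exists_minim_Card_order) (auto intro: card_of_Card_order)
  then obtain A where A: "A \<subseteq> topspace X" "\<not> codense X A"
    and min: "\<And>B. \<lbrakk>B \<subseteq> topspace X; \<not> codense X B\<rbrakk> \<Longrightarrow> |A| \<le>o |B|" by blast
  have small: "codense X B" if "B \<subseteq> topspace X" "|B| <o |A|" for B
    using min[OF that(1)] that(2) not_ordLess_ordLeq by blast
  have uncountable: "|UNIV :: nat set| <o |A|"
  proof -
    have "\<not> countable A" using codense_countable A by blast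
    then have "\<not> |A| \<le>o |UNIV :: nat set|"
      unfolding countable_def card_of_ordLeq[symmetric] by simp
    then show ?thesis
      by (simp add: not_ordLeq_iff_ordLess[OF card_of_Well_order card_of_Well_order])
  qed
  then have infA: "infinite A" 
    by (metis infinite_iff_card_of_nat ordLess_imp_ordLeq)
  have Field: "Field |A| = A" by (rule Field_card_of)
  have wo: "wo_rel |A|" using card_of_Well_order unfolding wo_rel_def by blast
  define C where "C a = ternary_hull h (underS |A| a)" for a
  define \<C> where "\<C> = C ` A"
  define Y where "Y = \<Union>\<C>"
  have underS_sub: "underS |A| a \<subseteq> A" for a
    using Order_Relation.underS_Field[of "|A|" a] Field by simp
  have C_sub: "C a \<subseteq> topspace X" for a
  proof
    fix x assume "x \<in> C a"
    then show "x \<in> topspace X" unfolding C_def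
      by induction (use underS_sub A(1) h_in in auto)
  qed
  have C_codense: "codense X (C a)" if a: "a \<in> A" for a
  proof (rule small[OF C_sub])
    have lt: "|underS |A| a| <o |A|"
      using card_of_underS[OF card_of_Card_order[of A]] a Field by simp
    show "|C a| <o |A|"
    proof (cases "finite (underS |A| a)")
      case True
      then have "|underS |A| a| \<le>o |UNIV :: nat set|"
        by (intro ordLess_imp_ordLeq finite_ordLess_infinite card_of_Well_order)
          (auto simp: Field_card_of)
      then have "|C a| \<le>o |UNIV :: nat set|"
        unfolding C_def by (rule card_of_ternary_hull[OF infinite_UNIV_nat])
      then show ?thesis using uncountable ordLeq_ordLess_trans by blast
    next
      case False
      have "|C a| \<le>o |underS |A| a|"
        unfolding C_def by (rule card_of_ternary_hull[OF False ordIso_imp_ordLeq[OF card_of_refl]])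
      then show ?thesis using lt ordLeq_ordLess_trans by blast
    qed
  qed
  have chain: "K \<subseteq> L \<or> L \<subseteq> K" if KL: "K \<in> \<C>" "L \<in> \<C>" for K L
  proof -
    obtain a b where ab: "a \<in> A" "b \<in> A" "K = C a" "L = C b" using KL unfolding \<C>_def by blast
    have "underS |A| a \<subseteq> underS |A| b \<or> underS |A| b \<subseteq> underS |A| a"
      using wo_rel.TOTALS[OF wo] ab Field underS_incr[OF wo_rel.TRANS[OF wo] wo_rel.ANTISYM[OF wo]]
      by blast
    then show ?thesis using ab ternary_hull_mono unfolding C_def by metis
  qed
  have Y_sub: "Y \<subseteq> topspace X" unfolding Y_def \<C>_def using C_sub by blast
  \<comment> \<open>The chain uses strict initial segments, so \<open>a\<close> is caught at a later index; one exists
    because an infinite cardinal has no last element.\<close>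
  have "A \<subseteq> Y"
  proof
    fix a assume a: "a \<in> A"
    then obtain b where "b \<in> A" "a \<noteq> b" "(a, b) \<in> |A|"
      using infinite_Card_order_limit[OF card_of_Card_order, of A a] infA Field by auto
    then have "a \<in> C b" unfolding C_def by (auto simp: underS_def intro: ternary_hull.base)
    then show "a \<in> Y" unfolding Y_def \<C>_def using \<open>b \<in> A\<close> by blast
  qed
  then have Y_not: "\<not> codense X Y" using A(2) codense_subset by blast
  have C_codense': "codense X K" if "K \<in> \<C>" for K
    using that C_codense unfolding \<C>_def by blast
  obtain \<zeta> where
    \<zeta>_inv: "\<And>K a b y. \<lbrakk>K \<in> \<C>; a \<in> K; b \<in> K; y \<in> Y - K\<rbrakk> \<Longrightarrow> \<zeta> (h a b y) = \<zeta> y"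
    and \<zeta>_fibre: "\<And>y. y \<in> Y \<Longrightarrow> \<exists>K\<in>\<C>. {z \<in> Y. \<zeta> z = \<zeta> y} \<subseteq> K"
    and \<zeta>_in: "\<And>y. y \<in> Y \<Longrightarrow> \<zeta> y \<in> Y"
  proof (rule chain_orbit_labelling[of \<C> h])
    show "h a b c \<in> K" if "K \<in> \<C>" "a \<in> K" "b \<in> K" "c \<in> K" for K a b c
      using that unfolding \<C>_def C_def by (auto intro: ternary_hull.step)
    show "h b a (h a b c) = c" if "a \<in> \<Union>\<C>" "b \<in> \<Union>\<C>" "c \<in> \<Union>\<C>" for a b c
      using h_inv that Y_sub unfolding Y_def by blast
  qed (use chain in \<open>auto simp: Y_def\<close>)
  define N where "N T \<longleftrightarrow> codense X {y \<in> Y. \<zeta> y \<in> T}" for T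
  have "N (topspace X)"
  proof (rule nonmeasurable_cardinality_prime_ideal[OF nm])
    show "N B" if "N A" "B \<subseteq> A" for A B
      using that(1) unfolding N_def by (rule codense_subset) (use that(2) in blast)
    show "N (\<Union>n. T n)" if "\<And>n. N (T n)" for T :: "nat \<Rightarrow> 'a set"
    proof -
      have "{y \<in> Y. \<zeta> y \<in> (\<Union>n. T n)} = (\<Union>n. {y \<in> Y. \<zeta> y \<in> T n})" by blast
      then show ?thesis using codense_UN[of "\<lambda>n. {y \<in> Y. \<zeta> y \<in> T n}"] that unfolding N_def by simp
    qed
    show "N {}" unfolding N_def by (simp add: codense_empty)
    show "N {x}" if "x \<in> topspace X" for x
    proof (cases "\<exists>y\<in>Y. \<zeta> y = x")
      case True
      then obtain K where "K \<in> \<C>" "{y \<in> Y. \<zeta> y \<in> {x}} \<subseteq> K" using \<zeta>_fibre by auto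
      then show ?thesis unfolding N_def using C_codense' codense_subset by blast
    next
      case False
      then have "{y \<in> Y. \<zeta> y \<in> {x}} = {}" by blast
      then show ?thesis unfolding N_def by (simp only: codense_empty)
    qed
    show "N T \<or> N (topspace X - T)" for T
    proof (rule ccontr)
      assume "\<not> ?thesis"
      then have T: "\<not> codense X {y \<in> Y. \<zeta> y \<in> T}" "\<not> codense X {y \<in> Y. \<zeta> y \<in> topspace X - T}"
        unfolding N_def by auto
      obtain U where U: "openin X U" "U \<subseteq> {y \<in> Y. \<zeta> y \<in> T}" "U \<noteq> {}"
        by (rule not_codenseE[OF T(1)]) (use Y_sub in auto)
      obtain U' where U': "openin X U'" "U' \<subseteq> {y \<in> Y. \<zeta> y \<in> topspace X - T}" "U' \<noteq> {}"
        by (rule not_codenseE[OF T(2)]) (use Y_sub in auto)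
      obtain a b where ab: "a \<in> U" "b \<in> U'" using U U' by blast
      then have abY: "a \<in> Y" "b \<in> Y" using U U' by blast+
      then obtain K where K: "K \<in> \<C>" "a \<in> K" "b \<in> K"
        using chain unfolding Y_def by blast
      have abX: "a \<in> topspace X" "b \<in> topspace X" using abY Y_sub by auto
      \<comment> \<open>On \<open>?W\<close> the map \<open>h a b\<close> takes labels in \<open>T\<close> to labels outside \<open>T\<close>.\<close>
      let ?W = "{y \<in> topspace X. h a b y \<in> U'} \<inter> U"
      have "openin X ?W"
        using h[OF abX] U(1) U'(1) unfolding homeomorphic_maps_def
        by (intro openin_Int) (auto intro: openin_continuous_map_preimage)
      moreover have "a \<in> ?W" using ab abX hab by auto
      ultimately have "\<not> ?W \<subseteq> K" using C_codense'[OF K(1)] unfolding codense_def by blast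
      then obtain y where y: "y \<in> ?W" "y \<notin> K" by blast
      then have "y \<in> Y - K" "\<zeta> y \<in> T" "\<zeta> (h a b y) \<notin> T" using U U' by auto
      then show False using \<zeta>_inv[OF K] by simp
    qed
  qed
  moreover have "{y \<in> Y. \<zeta> y \<in> topspace X} = Y" using \<zeta>_in Y_sub by blast
  ultimately show False using Y_not unfolding N_def by simp
qed

section \<open>Topological gyrogroups\<close>

context gyrogroup
begin

text \<open>
  Injectivity of \<open>gyr (neg a) a\<close> gives cancellation before that gyration is known to be trivial.
  Cancellation then shows that \<open>gyr zero a\<close> is trivial, and the loop property passes this on to
  \<open>gyr (neg a) a\<close>.
\<close>
lemma left_cancel:
  assumes a: "a \<in> G" and uv: "u \<in> G" "v \<in> G" and eq: "a \<oplus> u = a \<oplus> v"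
  shows "u = v"
proof -
  have "neg a \<oplus> (a \<oplus> w) = gyr (neg a) a w" if "w \<in> G" for w
  proof -
    have "gyr (neg a) a w \<in> G"
      using gyr_bij[of "neg a" a] a neg_closed that unfolding bij_betw_def by blast
    then show ?thesis
      using gyr_assoc[of "neg a" a w] a neg_closed neg_left zero_left that by simp
  qed
  then have "gyr (neg a) a u = gyr (neg a) a v" using uv eq by metis
  then show ?thesis
    using gyr_bij[of "neg a" a] a neg_closed uv unfolding bij_betw_def inj_on_def by blast
qed

lemma gyr_zero:
  assumes "a \<in> G" "z \<in> G"
  shows "gyr zero a z = z"
proof -
  have "gyr zero a z \<in> G"
    using gyr_bij[of zero a] assms zero_closed unfolding bij_betw_def by blast
  moreover have "a \<oplus> z = a \<oplus> gyr zero a z"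
    using gyr_assoc[of zero a z] assms zero_closed zero_left add_closed by simp
  ultimately show ?thesis using left_cancel assms by metis
qed

lemma neg_neg: "a \<in> G \<Longrightarrow> neg (neg a) = a"
  using neg_unique[of "neg a" a] neg_left neg_right neg_closed by simp

lemma neg_add_cancel:
  assumes a: "a \<in> G" and z: "z \<in> G"
  shows "neg a \<oplus> (a \<oplus> z) = z"
proof -
  have "gyr (neg a) a z = gyr (neg a \<oplus> a) a z"
    using gyr_loop[of "neg a" a z] a z neg_closed by simp
  also have "\<dots> = z" using gyr_zero neg_left a z by simp
  finally show ?thesis
    using gyr_assoc[of "neg a" a z] a z neg_closed neg_left zero_left by simp
qed

end

text \<open>
  Left translation by \<open>a\<close> has the continuous inverse \<open>add (neg a)\<close>, by left cancellation for \<open>a\<close>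
  and for \<open>neg a\<close>. Translating by \<open>neg x\<close> and then by \<open>y\<close> moves \<open>x\<close> to \<open>zero\<close> and on to \<open>y\<close>.
\<close>
lemma topological_gyrogroup_homogeneous:
  assumes "topological_gyrogroup X add zero neg gyr"
  shows "homogeneous_topology X"
proof -
  interpret T: topological_gyrogroup X add zero neg gyr by fact
  interpret gyrogroup "topspace X" add zero neg gyr by (rule T.gyrogroup)
  have cont: "continuous_map X X (add a)" if a: "a \<in> topspace X" for a
  proof -
    have "continuous_map X (prod_topology X X) (\<lambda>x. (a, x))"
      using a by (intro continuous_map_pairedI) auto
    from continuous_map_compose[OF this T.continuous_add] show ?thesis by (simp add: o_def)
  qed
  have trans: "homeomorphic_maps X X (add a) (add (neg a))" if a: "a \<in> topspace X" for a
    unfolding homeomorphic_maps_def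
    using cont a neg_closed neg_add_cancel neg_add_cancel[of "neg a"] neg_neg by auto
  show ?thesis unfolding homogeneous_topology_def
  proof (intro ballI)
    fix x y assume x: "x \<in> topspace X" and y: "y \<in> topspace X"
    have "homeomorphic_map X X (add y \<circ> add (neg x))"
      using trans[OF x] trans[OF y] homeomorphic_map_compose unfolding homeomorphic_maps_map by blast
    moreover have "(add y \<circ> add (neg x)) x = y" using x y neg_left zero_right by simp
    ultimately show "\<exists>f. homeomorphic_map X X f \<and> f x = y" by blast
  qed
qed

theorem corollary3p8:
  fixes X :: "'a topology"
    and add :: "'a \<Rightarrow> 'a \<Rightarrow> 'a"
    and zero :: 'a
    and neg :: "'a \<Rightarrow> 'a"
    and gyr :: "'a \<Rightarrow> 'a \<Rightarrow> 'a \<Rightarrow> 'a"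
  assumes "topological_gyrogroup X add zero neg gyr"
    and "Hausdorff_space X"
    and "dense_in_itself X"
    and "submaximal_space X"
    and "nonmeasurable_cardinality (topspace X)"
  shows "strongly_sigma_discrete X"
  by (rule homogeneous_submaximal_strongly_sigma_discrete
      [OF topological_gyrogroup_homogeneous[OF assms(1)] assms(3-5)])

end
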